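(* If a correlation-free cellular automaton (CFCA) is number-conserving, then it is a deterministic map.
   Context: A (one-dimensional) stochastic cellular automaton is a tuple $(Q,R,V,V',f)$ where $Q$ (states) and $R$ (random symbols) are finite sets, $V=\{v_1,\dots,v_\rho\}$ and $V'=\{v'_1,\dots,v'_{\rho'}\}$ are finite subsets of $\mathbb{Z}$, and $f:Q^\rho\times R^{\rho'}\to Q$. It is a CFCA if $V'=\{0\}$. Its explicit global function is $F:Q^{\mathbb{Z}}\times R^{\mathbb{Z}}\to Q^{\mathbb{Z}}$, $F(c,s)_z=f\big((c_{z+v_j})_j,(s_{z+v'_j})_j\big)$. For $c\in Q^{\mathbb{Z}}$, $\mathcal{S}_F(c)$ is the law of $F(c,s)$ when $s$ is drawn from the uniform (i.i.d. uniform product) measure on $R^{\mathbb{Z}}$. The automaton is deterministic if $f$ does not depend on its second argument (the random symbols). A configuration is finite if it has finitely many cells in a state other than $0$. A stochastic CA $F$ is number-conserving if $Q=\{0,\dots,q\}$ for some $q\in\mathbb{N}$ and for every finite configuration $c\in Q^{\mathbb{Z}}$, $\big(\mathcal{S}_F(c)\big)(\{c':\sum_i c'_i=\sum_i c_i\})=1$, where the sums range over all of $\mathbb{Z}$ and only finite configurations $c'$ are considered. *)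

theory Defs
  imports "HOL-Probability.Probability" "HOL-Library.Groups_Big_Fun"
begin

text \<open>
  The finite sets \<open>V = {v\<^sub>1, \<dots>}\<close> and \<open>V' = {v'\<^sub>1, \<dots>}\<close> of offsets are given by duplicate-free lists,
  which fix the enumeration by which the local rule \<open>f\<close> reads its arguments; a tuple in \<open>Q\<^sup>\<rho>\<close> is a
  list over \<open>Q\<close> of length \<open>\<rho>\<close>.
\<close>

record ('q, 'r) sca =
  states :: "'q set"                           (* Q *)
  symbols :: "'r set"                          (* R *)
  nbhd :: "int list"                           (* V *)
  rnbhd :: "int list"                          (* V' *)
  local_rule :: "'q list \<Rightarrow> 'r list \<Rightarrow> 'q"    (* f *)

definition tuples :: "'a set \<Rightarrow> nat \<Rightarrow> 'a list set" where
  "tuples X n = {xs. set xs \<subseteq> X \<and> length xs = n}"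

text \<open>
  \<open>R\<close> may be empty here, but no number-conserving automaton (in the sense below) has \<open>R = {}\<close>:
  the law of the image then lives on an empty sample space and has total mass \<open>0\<close>.
\<close>

definition stochastic_ca :: "('q, 'r) sca \<Rightarrow> bool" where
  "stochastic_ca A \<longleftrightarrow>
     finite (states A) \<and> finite (symbols A) \<and> distinct (nbhd A) \<and> distinct (rnbhd A) \<and>
     (\<forall>qs \<in> tuples (states A) (length (nbhd A)). \<forall>rs \<in> tuples (symbols A) (length (rnbhd A)).
        local_rule A qs rs \<in> states A)"

definition cfca :: "('q, 'r) sca \<Rightarrow> bool" where
  "cfca A \<longleftrightarrow> stochastic_ca A \<and> set (rnbhd A) = {0}"

definition deterministic_ca :: "('q, 'r) sca \<Rightarrow> bool" where
  "deterministic_ca A \<longleftrightarrow>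
     (\<forall>qs \<in> tuples (states A) (length (nbhd A)).
        \<forall>rs \<in> tuples (symbols A) (length (rnbhd A)). \<forall>rs' \<in> tuples (symbols A) (length (rnbhd A)).
          local_rule A qs rs = local_rule A qs rs')"

definition global_fun :: "('q, 'r) sca \<Rightarrow> (int \<Rightarrow> 'q) \<Rightarrow> (int \<Rightarrow> 'r) \<Rightarrow> (int \<Rightarrow> 'q)" where
  "global_fun A c s =
     (\<lambda>z. local_rule A (map (\<lambda>v. c (z + v)) (nbhd A)) (map (\<lambda>v. s (z + v)) (rnbhd A)))"

definition random_source :: "('q, 'r) sca \<Rightarrow> (int \<Rightarrow> 'r) measure" where
  "random_source A = (\<Pi>\<^sub>M z \<in> (UNIV :: int set). uniform_count_measure (symbols A))"

definition image_law :: "('q, 'r) sca \<Rightarrow> (int \<Rightarrow> 'q) \<Rightarrow> (int \<Rightarrow> 'q) measure" where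
  "image_law A c =
     distr (random_source A) (\<Pi>\<^sub>M z \<in> (UNIV :: int set). count_space (states A)) (global_fun A c)"

definition finite_config :: "(int \<Rightarrow> 'q::zero) \<Rightarrow> bool" where
  "finite_config c \<longleftrightarrow> finite {z. c z \<noteq> 0}"

text \<open>
  \<open>Sum_any c\<close> is the sum of \<open>c\<close> over all of \<open>\<int>\<close>; it defaults to \<open>0\<close> on infinite support, hence the
  explicit restriction of the event to finite \<open>c'\<close>.
\<close>

definition number_conserving :: "(nat, 'r) sca \<Rightarrow> bool" where
  "number_conserving A \<longleftrightarrow>
     (\<exists>q. states A = {0..q}) \<and>
     (\<forall>c \<in> UNIV \<rightarrow> states A. finite_config c \<longrightarrow>
        measure (image_law A c)
          {c' \<in> UNIV \<rightarrow> states A. finite_config c' \<and> Sum_any c' = Sum_any c} = 1)"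

end

theory Submission imports Defs
begin

text \<open>
  Take a configuration that shows the pattern \<open>qs\<close> at the origin and \<open>0\<close> elsewhere. As \<open>V' = {0}\<close>,
  resampling the random symbol at the origin alone changes at most the cell at the origin of the
  image. Almost every source preserves the sum whichever symbol is put at the origin, so
  the value at the origin cannot depend on that symbol.
\<close>

text \<open>Fubini with the coordinate \<open>i\<close> split off gives the claim for almost every
  symbol at \<open>i\<close>. As each symbol has positive mass, "almost every" means "every", so
  \<open>x\<close> may be fixed in advance.\<close>

lemma AE_PiM_uniform_count_fun_upd:
  assumes R: "finite R" and x: "x \<in> R" and i: "i \<in> I"
    and ae: "AE s in (\<Pi>\<^sub>M j \<in> I. uniform_count_measure R). P s"
  shows "AE s in (\<Pi>\<^sub>M j \<in> I - {i}. uniform_count_measure R). P (s(i := x))"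
proof -
  let ?M = "uniform_count_measure R"
  let ?J = "\<Pi>\<^sub>M j \<in> I - {i}. ?M"
  have R0: "R \<noteq> {}" using x by auto
  interpret M: prob_space ?M using R R0 by (rule prob_space_uniform_count_measure)
  interpret J: prob_space ?J by (intro prob_space_PiM M.prob_space_axioms)
  interpret pair_prob_space ?M ?J ..
  have ins: "insert i I = I" using i by auto
  have distr: "distr (?M \<Otimes>\<^sub>M ?J) (\<Pi>\<^sub>M j \<in> I. ?M) (\<lambda>(y, s). s(i := y)) = (\<Pi>\<^sub>M j \<in> I. ?M)"
    using distr_pair_PiM_eq_PiM[of "I - {i}" "\<lambda>_. ?M" i] M.prob_space_axioms
    by (simp add: ins)
  have meas: "(\<lambda>(y, s). s(i := y)) \<in> ?M \<Otimes>\<^sub>M ?J \<rightarrow>\<^sub>M (\<Pi>\<^sub>M j \<in> I. ?M)"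
    using measurable_compose[OF measurable_pair_swap' measurable_add_dim[of i "I - {i}" "\<lambda>_. ?M"]]
    by (simp add: ins case_prod_unfold)
  have "AE z in ?M \<Otimes>\<^sub>M ?J. P ((\<lambda>(y, s). s(i := y)) z)"
    by (rule AE_distrD[OF meas]) (simp only: distr ae)
  from AE_pair[OF this] have pair: "AE y in ?M. AE s in ?J. P (s(i := y))"
    by simp
  \<comment> \<open>The point masses of \<open>?M\<close> are \<open>1 / card R > 0\<close>, so its
    only null set within \<open>R\<close> is the empty one.\<close>
  have "(AE y in ?M. Q y) \<longleftrightarrow> (\<forall>y\<in>R. Q y)" for Q
    unfolding uniform_count_measure_def AE_point_measure
    using R by (auto simp: card_gt_0_iff)
  from bspec[OF iffD1[OF this pair] x] show ?thesis .
qed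

text \<open>On a common finite support containing \<open>a\<close>, all terms except the one at
  \<open>a\<close> agree and cancel. Finiteness keeps \<open>Sum_any\<close> away from its default
  value \<open>0\<close>.\<close>

lemma Sum_any_fun_upd_cancel:
  fixes d :: "'a \<Rightarrow> 'b::cancel_comm_monoid_add"
  assumes "finite {z. d z \<noteq> 0}" "finite {z. d' z \<noteq> 0}"
    and "\<And>z. z \<noteq> a \<Longrightarrow> d z = d' z" and "Sum_any d = Sum_any d'"
  shows "d = d'"
proof
  let ?S = "insert a ({z. d z \<noteq> 0} \<union> {z. d' z \<noteq> 0})"
  have "finite ?S" using assms by auto
  then have "Sum_any d = d a + sum d (?S - {a})" "Sum_any d' = d' a + sum d' (?S - {a})"
    by (subst Sum_any.expand_superset[of ?S], auto simp: sum.remove[of ?S a])+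
  moreover have "sum d (?S - {a}) = sum d' (?S - {a})"
    by (rule sum.cong) (use assms(3) in auto)
  ultimately have "d a = d' a" using assms(4) by simp
  then show "d z = d' z" for z using assms(3) by (cases "z = a") auto
qed

lemma cfca_rnbhd:
  assumes "cfca A"
  shows "rnbhd A = [0]"
proof -
  have "set (rnbhd A) = {0}" "distinct (rnbhd A)"
    using assms by (auto simp: cfca_def stochastic_ca_def)
  then show ?thesis
    by (cases "rnbhd A"; cases "tl (rnbhd A)") (auto simp: subset_singleton_iff insert_eq_iff)
qed

text \<open>Cell \<open>z\<close> of the image depends on the source only through
  \<open>s z\<close>, which ranges over a discrete space.\<close>

lemma measurable_global_fun:
  assumes A: "cfca A" and c: "c \<in> UNIV \<rightarrow> states A"
  shows "global_fun A c \<in> random_source A \<rightarrow>\<^sub>M (\<Pi>\<^sub>M z \<in> UNIV. count_space (states A))"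
proof -
  have "local_rule A (map (\<lambda>v. c (z + v)) (nbhd A)) [x] \<in> states A" if "x \<in> symbols A" for z x
  proof -
    have "map (\<lambda>v. c (z + v)) (nbhd A) \<in> tuples (states A) (length (nbhd A))"
      using c by (auto simp: tuples_def)
    moreover have "[x] \<in> tuples (symbols A) (length (rnbhd A))"
      using that by (simp add: tuples_def cfca_rnbhd[OF A])
    ultimately show ?thesis using A by (simp add: cfca_def stochastic_ca_def)
  qed
  then have "(\<lambda>x. local_rule A (map (\<lambda>v. c (z + v)) (nbhd A)) [x])
          \<in> uniform_count_measure (symbols A) \<rightarrow>\<^sub>M count_space (states A)" for z
    by (auto simp: measurable_def space_uniform_count_measure sets_uniform_count_measure)
  then have m: "(\<lambda>s. local_rule A (map (\<lambda>v. c (z + v)) (nbhd A)) [s z])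
          \<in> random_source A \<rightarrow>\<^sub>M count_space (states A)" for z
    unfolding random_source_def
    by (rule measurable_compose[OF measurable_component_singleton[OF UNIV_I]])
  have "(\<lambda>s z. local_rule A (map (\<lambda>v. c (z + v)) (nbhd A)) [s z])
          \<in> random_source A \<rightarrow>\<^sub>M (\<Pi>\<^sub>M z \<in> UNIV. count_space (states A))"
    by (intro measurable_PiM_single' m) (use m[THEN measurable_space] in auto)
  then show ?thesis
    by (simp add: global_fun_def[abs_def] cfca_rnbhd[OF A])
qed

text \<open>This pulls the condition on the law of the image back to the random source, where single
  symbols can be changed.\<close>

lemma AE_number_conserving:
  assumes A: "cfca A" and nc: "number_conserving A" and R: "symbols A \<noteq> {}"
    and c: "c \<in> UNIV \<rightarrow> states A" "finite_config c"
  shows "AE s in random_source A.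
           finite_config (global_fun A c s) \<and> Sum_any (global_fun A c s) = Sum_any c"
proof -
  have "finite (symbols A)" using A by (auto simp: cfca_def stochastic_ca_def)
  then interpret P: prob_space "random_source A"
    unfolding random_source_def
    by (intro prob_space_PiM prob_space_uniform_count_measure R)
  interpret L: prob_space "image_law A c"
    unfolding image_law_def by (rule P.prob_space_distr[OF measurable_global_fun[OF A c(1)]])
  have "AE c' in image_law A c. c' \<in> {c' \<in> UNIV \<rightarrow> states A. finite_config c' \<and> Sum_any c' = Sum_any c}"
    \<comment> \<open>The event is measurable because its \<open>measure\<close> is
      \<open>1\<close>: a non-measurable set would get the default \<open>0\<close>.\<close>
    using nc c by (intro L.AE_prob_1) (auto simp: number_conserving_def)
  then show ?thesis
    unfolding image_law_def by (auto dest: AE_distrD[OF measurable_global_fun[OF A c(1)]])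
qed

text \<open>Seen from cell \<open>0\<close>, the offsets in \<open>V\<close> are the positions
  themselves, so it suffices to write \<open>qs\<close> there and \<open>0\<close> elsewhere.
  Distinct offsets rule out clashes.\<close>

lemma ex_finite_config_pattern:
  assumes "distinct V" and "set qs \<subseteq> Q" "length qs = length V" and "0 \<in> Q"
  obtains c where "c \<in> UNIV \<rightarrow> Q" "finite_config c" "map c V = qs"
proof
  let ?c = "\<lambda>z. case map_of (zip V qs) z of None \<Rightarrow> 0 | Some y \<Rightarrow> y"
  have "?c z \<in> Q" for z
    using assms by (auto split: option.split dest!: map_of_SomeD set_zip_rightD)
  then show "?c \<in> UNIV \<rightarrow> Q" by auto
  have "{z. ?c z \<noteq> 0} \<subseteq> set V"
    by (auto split: option.splits dest!: map_of_SomeD set_zip_leftD)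
  then show "finite_config ?c"
    unfolding finite_config_def by (rule finite_subset) simp
  show "map ?c V = qs"
    using assms by (auto intro!: nth_equalityI simp: map_of_zip_nth)
qed

theorem lemma5p3:
  fixes A :: "(nat, 'r) sca"
  assumes "cfca A"
    and "number_conserving A"
  shows "deterministic_ca A"
proof -
  note rn = cfca_rnbhd[OF assms(1)]
  have fin: "finite (symbols A)" and V: "distinct (nbhd A)"
    using assms(1) by (auto simp: cfca_def stochastic_ca_def)
  have Q: "0 \<in> states A" using assms(2) by (auto simp: number_conserving_def)
  have "local_rule A qs [r] = local_rule A qs [r']"
    if qs: "qs \<in> tuples (states A) (length (nbhd A))"
      and r: "r \<in> symbols A" "r' \<in> symbols A" for qs r r'
  proof -
    obtain c where c: "c \<in> UNIV \<rightarrow> states A" "finite_config c" "map c (nbhd A) = qs"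
      using ex_finite_config_pattern[OF V _ _ Q] qs by (auto simp: tuples_def)
    let ?P = "\<lambda>s. finite_config (global_fun A c s) \<and> Sum_any (global_fun A c s) = Sum_any c"
    let ?J = "\<Pi>\<^sub>M z \<in> UNIV - {0::int}. uniform_count_measure (symbols A)"
    have "AE s in (\<Pi>\<^sub>M z \<in> UNIV. uniform_count_measure (symbols A)). ?P s"
      unfolding random_source_def[symmetric]
      \<comment> \<open>The symbol \<open>r\<close> witnesses that \<open>symbols A\<close> is
        nonempty.\<close>
      by (rule AE_number_conserving[OF assms _ c(1,2)]) (use r(1) in auto)
    from AE_PiM_uniform_count_fun_upd[OF fin _ UNIV_I this]
    have upd: "AE s in ?J. ?P (s(0 := x))" if "x \<in> symbols A" for x
      using that .
    interpret J: prob_space ?J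
      using r(1) by (intro prob_space_PiM prob_space_uniform_count_measure fin) auto
    have "AE s in ?J. ?P (s(0 := r)) \<and> ?P (s(0 := r'))"
      using upd[OF r(1)] upd[OF r(2)] by eventually_elim blast
    \<comment> \<open>A probability space is not null, so one choice of symbols off the origin
      serves both \<open>r\<close> and \<open>r'\<close>.\<close>
    from eventually_happens[OF this] obtain s where s: "?P (s(0 := r))" "?P (s(0 := r'))"
      using J.ae_filter_bot by auto
    \<comment> \<open>The two sources differ only at \<open>0\<close>, and each cell reads only its
      own symbol, so the images agree off \<open>0\<close>.\<close>
    have "global_fun A c (s(0 := r)) = global_fun A c (s(0 := r'))"
      using s by (intro Sum_any_fun_upd_cancel[where a = 0])
        (auto simp: finite_config_def global_fun_def rn)
    from fun_cong[OF this, of 0] show ?thesis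
      using c(3) by (simp add: global_fun_def rn)
  qed
  \<comment> \<open>Random tuples have length one, so the claim for single symbols covers them all;
    without symbols there are none.\<close>
  moreover have "\<exists>r \<in> symbols A. rs = [r]" if "rs \<in> tuples (symbols A) (length (rnbhd A))" for rs
    using that by (auto simp: rn tuples_def length_Suc_conv)
  ultimately show ?thesis
    unfolding deterministic_ca_def by metis
qed

end
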